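(* Let $m\geqslant 1$ be an integer, let $G$ be a subgroup of the symmetric group $\mathfrak{S}_m$, let $\chi$ be an irreducible (complex) character of $G$, and let $d_\chi^G$ be the associated generalized matrix function ($G$-immanant) on $m\times m$ complex matrices. Let $A,B,C$ be $m\times m$ Hermitian positive semidefinite complex matrices. Then $$d_\chi^G(A+B+C)+d_\chi^G(A)+d_\chi^G(B)+d_\chi^G(C)\ \geqslant\ d_\chi^G(A+B)+d_\chi^G(A+C)+d_\chi^G(B+C).$$
   Context: For a subgroup $G$ of the symmetric group $\mathfrak{S}_m$ and an irreducible character $\chi$ of $G$, the $G$-immanant (generalized matrix function) of an $m\times m$ complex matrix $X=(x_{ij})$ is $d_\chi^G(X):=\sum_{\sigma\in G}\chi(\sigma)\prod_{i=1}^m x_{i,\sigma(i)}$. On Hermitian positive semidefinite matrices its values are real, so the inequality is one between real numbers. *)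

theory Defs
  imports
    "HOL-Algebra.Sym_Groups"
    "Jordan_Normal_Form.Schur_Decomposition"
    "Jordan_Normal_Form.VS_Connect"
begin

(* On complex, x \<le> y means Re x \<le> Re y and Im x = Im y (HOL-Library.Complex_Order), so the
   last conjunct says that the quadratic form is real and nonnegative. *)
definition psd_mat :: "complex mat \<Rightarrow> bool" where
  "psd_mat A \<longleftrightarrow> square_mat A \<and> mat_adjoint A = A \<and>
     (\<forall>v \<in> carrier_vec (dim_row A). 0 \<le> (A *\<^sub>v v) \<bullet>c v)"

definition mat_trace :: "'a :: comm_monoid_add mat \<Rightarrow> 'a" where
  "mat_trace A = (\<Sum>i<dim_row A. A $$ (i, i))"

abbreviation GL_mat :: "nat \<Rightarrow> complex mat monoid" where
  "GL_mat d \<equiv> units_of (ring_mat TYPE(complex) d ())"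

definition irreducible_rep ::
  "('a, 'b) monoid_scheme \<Rightarrow> nat \<Rightarrow> ('a \<Rightarrow> complex mat) \<Rightarrow> bool" where
  "irreducible_rep G d \<rho> \<longleftrightarrow> \<rho> \<in> hom G (GL_mat d) \<and> d > 0 \<and>
     (\<forall>W. VectorSpace.subspace class_ring W (module_vec TYPE(complex) d) \<longrightarrow>
        (\<forall>g \<in> carrier G. \<forall>w \<in> W. \<rho> g *\<^sub>v w \<in> W) \<longrightarrow>
        W = {0\<^sub>v d} \<or> W = carrier_vec d)"

definition irreducible_character ::
  "('a, 'b) monoid_scheme \<Rightarrow> ('a \<Rightarrow> complex) \<Rightarrow> bool" where
  "irreducible_character G \<chi> \<longleftrightarrow>
     (\<exists>d \<rho>. irreducible_rep G d \<rho> \<and> (\<forall>g \<in> carrier G. \<chi> g = mat_trace (\<rho> g)))"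

(* Permutations in sym_group m act on {1..m}, whereas matrix entries are indexed from 0;
   hence the shift by one. *)
definition immanant ::
  "nat \<Rightarrow> (nat \<Rightarrow> nat) set \<Rightarrow> ((nat \<Rightarrow> nat) \<Rightarrow> complex) \<Rightarrow> complex mat \<Rightarrow> complex" where
  "immanant m G \<chi> X = (\<Sum>\<sigma>\<in>G. \<chi> \<sigma> * (\<Prod>i=1..m. X $$ (i - 1, \<sigma> i - 1)))"

end

theory Submission
  imports Defs
begin

text \<open>
  Write \<open>\<Delta> F\<close> for the combination \<open>F(A+B+C) + F(A) + F(B) + F(C) - F(A+B) - F(A+C) - F(B+C)\<close>; the claim is
  that \<open>\<Delta> F\<close> is nonnegative for the immanant \<open>F\<close>.  Averaging over the group turns the single sum that
  defines the immanant into a pairing of two kernels on \<open>G\<close>: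
  \<open>|G| F(X) = \<Sum>\<^sub>s \<Sum>\<^sub>t \<chi>(t s\<^sup>-\<^sup>1) \<Prod>\<^sub>i X(s(i), t(i))\<close>, with \<open>s\<close> and \<open>t\<close> ranging over \<open>G\<close>,
  because the product is unchanged when \<open>s\<close> and \<open>t\<close> are both composed on the right with an element of the
  symmetric group (\<open>immanant_average\<close>).  This is linear in the product kernel, so \<open>|G| \<Delta> F\<close> pairs
  \<open>\<chi>(t s\<^sup>-\<^sup>1)\<close> with \<open>\<Delta>\<close> of the product kernel.  By Schur's product theorem the pairing is nonnegative
  (\<open>psd_kernel_pairing_nonneg\<close>) once both kernels are positive semidefinite.

  For the product kernel: if one multiplies out the products in \<open>\<Delta>\<close>, all terms cancel except those
  in which each of \<open>A\<close>, \<open>B\<close>, \<open>C\<close> occurs as a factor, and these have coefficient one.  They are entrywise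
  products of positive semidefinite kernels, hence positive semidefinite.  The induction in
  \<open>psd_kernel_prod_third_difference\<close> carries this out one factor at a time.

  For the character of a representation \<open>\<rho>\<close>: with the invariant form \<open>H = \<Sum>\<^sub>g \<rho>(g)\<^sup>* \<rho>(g)\<close> one has
  \<open>\<chi>(t s\<^sup>-\<^sup>1) = tr (\<rho>(t) H\<^sup>-\<^sup>1 \<rho>(s)\<^sup>* H)\<close>, so the quadratic form of the kernel at \<open>c\<close> is
  \<open>tr (R H\<^sup>-\<^sup>1 R\<^sup>* H)\<close> for a linear combination \<open>R\<close> of the \<open>\<rho>(t)\<close>.  This is the trace of a product of two
  positive semidefinite matrices, which is again a pairing of kernels (\<open>character_form_nonneg\<close>).
\<close>

section \<open>Positive semidefinite kernels on finite sets\<close>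

text \<open>
  The index set is arbitrary because the kernels live on the group as well as on the matrix
  indices.
\<close>

definition psd_kernel :: "'a set \<Rightarrow> ('a \<Rightarrow> 'a \<Rightarrow> complex) \<Rightarrow> bool" where
  "psd_kernel I K \<longleftrightarrow> (\<forall>i\<in>I. \<forall>j\<in>I. K j i = cnj (K i j)) \<and>
     (\<forall>c. 0 \<le> (\<Sum>i\<in>I. \<Sum>j\<in>I. c i * K i j * cnj (c j)))"

lemma psd_kernelI:
  assumes "\<And>i j. i \<in> I \<Longrightarrow> j \<in> I \<Longrightarrow> K j i = cnj (K i j)"
    and "\<And>c. 0 \<le> (\<Sum>i\<in>I. \<Sum>j\<in>I. c i * K i j * cnj (c j))"
  shows "psd_kernel I K"
  using assms unfolding psd_kernel_def by blast

lemma psd_kernel_hermitian: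
  "psd_kernel I K \<Longrightarrow> i \<in> I \<Longrightarrow> j \<in> I \<Longrightarrow> K j i = cnj (K i j)"
  unfolding psd_kernel_def by blast

lemma psd_kernel_form_nonneg:
  "psd_kernel I K \<Longrightarrow> 0 \<le> (\<Sum>i\<in>I. \<Sum>j\<in>I. c i * K i j * cnj (c j))"
  unfolding psd_kernel_def by blast

lemma psd_kernel_cong:
  assumes "psd_kernel I K" "\<And>i j. i \<in> I \<Longrightarrow> j \<in> I \<Longrightarrow> K i j = L i j"
  shows "psd_kernel I L"
proof (rule psd_kernelI)
  fix i j assume "i \<in> I" "j \<in> I"
  then show "L j i = cnj (L i j)"
    using psd_kernel_hermitian[OF assms(1), of i j] by (simp add: assms(2))
next
  fix c
  show "0 \<le> (\<Sum>i\<in>I. \<Sum>j\<in>I. c i * L i j * cnj (c j))"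
    using psd_kernel_form_nonneg[OF assms(1), of c] by (simp add: assms(2))
qed

lemma complex_nonneg_iff: "0 \<le> (z::complex) \<longleftrightarrow> 0 \<le> Re z \<and> Im z = 0"
  by (auto simp: less_eq_complex_def)

text \<open>The computation behind positivity of Gram matrices; the exact value, not only its sign, is
  needed to see that the averaged form of a representation is definite.\<close>

lemma gram_form:
  fixes v :: "'k \<Rightarrow> 'a \<Rightarrow> complex"
  shows "(\<Sum>i\<in>I. \<Sum>j\<in>I. c i * (\<Sum>k\<in>S. v k i * cnj (v k j)) * cnj (c j))
    = of_real (\<Sum>k\<in>S. (cmod (\<Sum>i\<in>I. c i * v k i))\<^sup>2)"
proof -
  have "of_real (\<Sum>k\<in>S. (cmod (\<Sum>i\<in>I. c i * v k i))\<^sup>2)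
      = (\<Sum>k\<in>S. (\<Sum>i\<in>I. c i * v k i) * cnj (\<Sum>j\<in>I. c j * v k j))"
    by (simp only: of_real_sum complex_norm_square)
  also have "\<dots> = (\<Sum>k\<in>S. \<Sum>i\<in>I. \<Sum>j\<in>I. (c i * v k i) * (cnj (c j) * cnj (v k j)))"
    by (simp add: sum_product)
  also have "\<dots> = (\<Sum>i\<in>I. \<Sum>j\<in>I. \<Sum>k\<in>S. (c i * v k i) * (cnj (c j) * cnj (v k j)))"
    by (subst sum.swap, rule sum.cong[OF refl], rule sum.swap)
  also have "\<dots> = (\<Sum>i\<in>I. \<Sum>j\<in>I. c i * (\<Sum>k\<in>S. v k i * cnj (v k j)) * cnj (c j))"
    by (simp add: sum_distrib_left sum_distrib_right mult_ac)
  finally show ?thesis ..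
qed

lemma psd_kernel_gram:
  assumes "\<And>i j. i \<in> I \<Longrightarrow> j \<in> I \<Longrightarrow> K i j = (\<Sum>k\<in>S. v k i * cnj (v k j))"
  shows "psd_kernel I K"
proof -
  have "0 \<le> (\<Sum>i\<in>I. \<Sum>j\<in>I. c i * K i j * cnj (c j))" for c
  proof -
    have "(\<Sum>i\<in>I. \<Sum>j\<in>I. c i * K i j * cnj (c j))
        = (\<Sum>i\<in>I. \<Sum>j\<in>I. c i * (\<Sum>k\<in>S. v k i * cnj (v k j)) * cnj (c j))"
      by (simp add: assms)
    then show ?thesis
      unfolding gram_form by (simp add: complex_nonneg_iff sum_nonneg)
  qed
  then show ?thesis
    by (intro psd_kernelI) (simp_all add: assms mult.commute)
qed

text \<open>The quadratic form on the enlarged index set, split according to the coefficient \<open>y\<close> at the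
  new point.  Choosing \<open>y\<close> suitably yields both steps of the Cholesky decomposition below.\<close>

lemma psd_kernel_form_insert:
  assumes "finite I" "a \<notin> I" "psd_kernel (insert a I) K"
  shows "0 \<le> (\<Sum>i\<in>I. \<Sum>j\<in>I. c i * K i j * cnj (c j))
      + cnj y * (\<Sum>i\<in>I. c i * K i a) + y * cnj (\<Sum>i\<in>I. c i * K i a) + y * cnj y * K a a"
proof -
  define d where "d = c(a := y)"
  have da: "d a = y" and di: "\<And>i. i \<in> I \<Longrightarrow> d i = c i"
    using assms(2) by (auto simp: d_def)
  have herm: "K a j = cnj (K j a)" if "j \<in> I" for j
    using that by (intro psd_kernel_hermitian[OF assms(3)]) auto
  have "0 \<le> (\<Sum>i\<in>insert a I. \<Sum>j\<in>insert a I. d i * K i j * cnj (d j))"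
    by (rule psd_kernel_form_nonneg[OF assms(3)])
  also have "\<dots> = (y * K a a * cnj y + (\<Sum>j\<in>I. y * K a j * cnj (d j)))
      + (\<Sum>i\<in>I. d i * K i a * cnj y + (\<Sum>j\<in>I. d i * K i j * cnj (d j)))"
    using assms(1,2) by (simp add: da)
  also have "(\<Sum>j\<in>I. y * K a j * cnj (d j)) = (\<Sum>j\<in>I. y * cnj (c j * K j a))"
    by (rule sum.cong) (simp_all add: di herm)
  also have "\<dots> = y * cnj (\<Sum>j\<in>I. c j * K j a)"
    by (simp add: sum_distrib_left)
  also have "(\<Sum>i\<in>I. d i * K i a * cnj y + (\<Sum>j\<in>I. d i * K i j * cnj (d j)))
      = (\<Sum>i\<in>I. cnj y * (c i * K i a) + (\<Sum>j\<in>I. c i * K i j * cnj (c j)))"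
    by (rule sum.cong) (simp_all add: di)
  also have "\<dots> = cnj y * (\<Sum>i\<in>I. c i * K i a) + (\<Sum>i\<in>I. \<Sum>j\<in>I. c i * K i j * cnj (c j))"
    by (simp add: sum.distrib sum_distrib_left)
  also have "(y * K a a * cnj y + y * cnj (\<Sum>j\<in>I. c j * K j a)) + \<dots>
      = (\<Sum>i\<in>I. \<Sum>j\<in>I. c i * K i j * cnj (c j))
      + cnj y * (\<Sum>i\<in>I. c i * K i a) + y * cnj (\<Sum>i\<in>I. c i * K i a) + y * cnj y * K a a"
    by (simp only: ac_simps)
  finally show ?thesis .
qed

lemma psd_kernel_diag:
  assumes "finite I" "psd_kernel I K" "a \<in> I"
  shows "0 \<le> K a a"
  using psd_kernel_form_insert[of "I - {a}" a K "\<lambda>_. 0" 1] assms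
  by (simp add: insert_absorb)

text \<open>Otherwise the form would be an affine, nonconstant function of the coefficient at \<open>a\<close>, and so
  would take negative values.\<close>

lemma psd_kernel_zero_diag:
  assumes "finite I" "psd_kernel I K" "a \<in> I" "i \<in> I" "K a a = 0"
  shows "K i a = 0"
proof (rule ccontr)
  assume nz: "K i a \<noteq> 0"
  with assms have ia: "i \<noteq> a" by auto
  define J where "J = I - {a}"
  have J: "finite J" "a \<notin> J" "psd_kernel (insert a J) K" "i \<in> J"
    using assms ia by (auto simp: J_def insert_absorb)
  define n where "n = (cmod (K i a))\<^sup>2"
  have n: "n > 0" using nz by (simp add: n_def)
  \<comment> \<open>With coefficients \<open>1\<close> at \<open>i\<close> and \<open>- t * K i a\<close> at \<open>a\<close> the form is \<open>K i i - 2 * t * n\<close>; this \<open>t\<close> makes it \<open>-1\<close>.\<close>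
  define t where "t = (Re (K i i) + 1) / (2 * n)"
  define c where "c = (\<lambda>j. if j = i then 1 else 0 :: complex)"
  have s: "(\<Sum>j\<in>J. c j * f j) = f i" for f
    using J by (simp add: c_def if_distrib[of "\<lambda>x. x * _"] sum.delta cong: if_cong)
  have s2: "(\<Sum>j\<in>J. c i' * K i' j * cnj (c j)) = c i' * K i' i" for i'
  proof -
    have "(\<Sum>j\<in>J. c i' * K i' j * cnj (c j)) = (\<Sum>j\<in>J. c j * (c i' * K i' j))"
      by (rule sum.cong) (auto simp: c_def)
    then show ?thesis by (simp add: s)
  qed
  have "0 \<le> K i i + cnj (- of_real t * K i a) * K i a + (- of_real t * K i a) * cnj (K i a)"
    using psd_kernel_form_insert[OF J(1-3), of c "- of_real t * K i a"] assms(5)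
    by (simp add: s s2)
  also have "\<dots> = K i i - of_real (2 * t * n)"
    by (simp add: n_def complex_norm_square mult_ac del: of_real_power)
  finally have "0 \<le> Re (K i i) - 2 * t * n"
    by (simp add: complex_nonneg_iff)
  then show False
    using n by (simp add: t_def)
qed

text \<open>Minimizing the form over the coefficient at \<open>a\<close> leaves exactly the form of the Schur complement.
  If the pivot \<open>K a a\<close> is zero, division by zero makes the complement equal to \<open>K\<close> on \<open>I\<close>, which is
  again the right kernel.\<close>

lemma psd_kernel_schur_complement:
  assumes "finite I" "a \<notin> I" "psd_kernel (insert a I) K"
  shows "psd_kernel I (\<lambda>i j. K i j - K i a * cnj (K j a) / K a a)"
proof -
  have real: "cnj (K a a) = K a a"
    using psd_kernel_hermitian[OF assms(3), of a a] by simp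
  have form: "0 \<le> (\<Sum>i\<in>I. \<Sum>j\<in>I. c i * (K i j - K i a * cnj (K j a) / K a a) * cnj (c j))" for c
  proof -
    define s where "s = (\<Sum>i\<in>I. c i * K i a)"
    have "(\<Sum>i\<in>I. \<Sum>j\<in>I. c i * (K i j - K i a * cnj (K j a) / K a a) * cnj (c j))
        = (\<Sum>i\<in>I. \<Sum>j\<in>I. c i * K i j * cnj (c j) - (c i * K i a) * (cnj (c j) * cnj (K j a)) / K a a)"
      by (simp add: algebra_simps)
    also have "\<dots> = (\<Sum>i\<in>I. \<Sum>j\<in>I. c i * K i j * cnj (c j)) - s * cnj s / K a a"
      by (simp add: s_def sum_subtractf sum_product sum_divide_distrib)
    also have "\<dots> = (\<Sum>i\<in>I. \<Sum>j\<in>I. c i * K i j * cnj (c j))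
        + cnj (- s / K a a) * s + (- s / K a a) * cnj s + (- s / K a a) * cnj (- s / K a a) * K a a"
      by (cases "K a a = 0") (simp_all add: real)
    also have "\<dots> \<ge> 0"
      using psd_kernel_form_insert[OF assms, of c "- s / K a a"] by (simp add: s_def)
    finally show ?thesis .
  qed
  moreover have "K j i - K j a * cnj (K i a) / K a a = cnj (K i j - K i a * cnj (K j a) / K a a)"
    if "i \<in> I" "j \<in> I" for i j
    using psd_kernel_hermitian[OF assms(3), of i j] that by (simp add: real)
  ultimately show ?thesis
    by (rule psd_kernelI[rotated])
qed

text \<open>Cholesky decomposition: each pivot \<open>a\<close> contributes the vector \<open>K i a / sqrt (K a a)\<close>, and the
  induction continues with the Schur complement.\<close>

lemma psd_kernel_imp_gram:
  assumes "finite I" "psd_kernel I K"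
  shows "\<exists>v. \<forall>i\<in>I. \<forall>j\<in>I. K i j = (\<Sum>k\<in>I. v k i * cnj (v k j))"
  using assms
proof (induction I arbitrary: K rule: finite_induct)
  case empty
  then show ?case by simp
next
  case (insert a I)
  obtain v where v: "\<And>i j. i \<in> I \<Longrightarrow> j \<in> I \<Longrightarrow>
      K i j - K i a * cnj (K j a) / K a a = (\<Sum>k\<in>I. v k i * cnj (v k j))"
    using insert.IH[OF psd_kernel_schur_complement[OF insert.hyps insert.prems]] by blast
  have pos: "0 \<le> K a a"
    using psd_kernel_diag[of "insert a I" K a] insert.hyps insert.prems by simp
  define r where "r = complex_of_real (sqrt (Re (K a a)))"
  have r: "r * r = K a a" "cnj r = r"
    using pos by (simp_all add: r_def complex_nonneg_iff complex_eq_iff)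
  have zero: "K i a = 0" if "r = 0" "i \<in> insert a I" for i
    using psd_kernel_zero_diag[of "insert a I" K a i] insert.hyps insert.prems r that by simp
  have herm: "K a j = cnj (K j a)" if "j \<in> insert a I" for j
    using that by (intro psd_kernel_hermitian[OF insert.prems]) auto
  define w where "w = (\<lambda>k i. if k = a then K i a / r else if i = a then 0 else v k i)"
  have "K i j = (\<Sum>k\<in>insert a I. w k i * cnj (w k j))"
    if ij: "i \<in> insert a I" "j \<in> insert a I" for i j
  proof -
    \<comment> \<open>Also for \<open>r = 0\<close>: then both \<open>K i a / r\<close> and the quotient by \<open>K a a\<close> are zero by convention.\<close>
    have "(\<Sum>k\<in>insert a I. w k i * cnj (w k j)) = K i a * cnj (K j a) / K a a + (\<Sum>k\<in>I. w k i * cnj (w k j))"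
      using insert.hyps by (simp add: w_def r flip: r(1))
    also have "(\<Sum>k\<in>I. w k i * cnj (w k j)) = (if i = a \<or> j = a then 0 else \<Sum>k\<in>I. v k i * cnj (v k j))"
      using insert.hyps by (auto simp: w_def intro!: sum.neutral sum.cong)
    also have "K i a * cnj (K j a) / K a a + \<dots> = K i j"
    proof (cases "i = a \<or> j = a")
      case True
      then show ?thesis
      proof (cases "r = 0")
        case True
        have "K i j = 0" using \<open>i = a \<or> j = a\<close> zero[OF True] ij herm by auto
        then show ?thesis using True \<open>i = a \<or> j = a\<close> r by auto
      next
        case False
        then have "K a a \<noteq> 0" using r by auto
        then show ?thesis using True herm[OF ij(1)] herm[OF ij(2)] herm[of a] by auto
      qed
    next
      case False
      then show ?thesis using ij by (simp flip: v)
    qed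
    finally show ?thesis ..
  qed
  then show ?case by blast
qed

text \<open>Writing \<open>K\<close> as a sum of rank-one kernels turns the pairing into a sum of values of the
  quadratic form of \<open>L\<close>.\<close>

lemma psd_kernel_pairing_nonneg:
  assumes "finite I" "psd_kernel I K"
    and L: "\<And>c. 0 \<le> (\<Sum>i\<in>I. \<Sum>j\<in>I. c i * L i j * cnj (c j))"
  shows "0 \<le> (\<Sum>i\<in>I. \<Sum>j\<in>I. K i j * L i j)"
proof -
  obtain v where v: "\<And>i j. i \<in> I \<Longrightarrow> j \<in> I \<Longrightarrow> K i j = (\<Sum>k\<in>I. v k i * cnj (v k j))"
    using psd_kernel_imp_gram[OF assms(1,2)] by blast
  have "(\<Sum>i\<in>I. \<Sum>j\<in>I. K i j * L i j) = (\<Sum>i\<in>I. \<Sum>j\<in>I. \<Sum>k\<in>I. v k i * L i j * cnj (v k j))"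
    by (simp add: v sum_distrib_right sum_distrib_left mult_ac cong: sum.cong)
  also have "\<dots> = (\<Sum>i\<in>I. \<Sum>k\<in>I. \<Sum>j\<in>I. v k i * L i j * cnj (v k j))"
    by (rule sum.cong[OF refl], rule sum.swap)
  also have "\<dots> = (\<Sum>k\<in>I. \<Sum>i\<in>I. \<Sum>j\<in>I. v k i * L i j * cnj (v k j))"
    by (rule sum.swap)
  also have "\<dots> \<ge> 0"
    by (intro sum_nonneg L)
  finally show ?thesis .
qed

text \<open>Schur's product theorem, from the pairing of \<open>K\<close> with the kernel \<open>c i * L i j * cnj (c j)\<close>.\<close>

lemma psd_kernel_times:
  assumes "finite I" "psd_kernel I K" "psd_kernel I L"
  shows "psd_kernel I (\<lambda>i j. K i j * L i j)"
proof -
  have "0 \<le> (\<Sum>i\<in>I. \<Sum>j\<in>I. c i * (K i j * L i j) * cnj (c j))" for c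
  proof -
    have "0 \<le> (\<Sum>i\<in>I. \<Sum>j\<in>I. d i * (c i * L i j * cnj (c j)) * cnj (d j))" for d
    proof -
      have "0 \<le> (\<Sum>i\<in>I. \<Sum>j\<in>I. (d i * c i) * L i j * cnj (d j * c j))"
        by (rule psd_kernel_form_nonneg[OF assms(3)])
      then show ?thesis by (simp add: mult_ac)
    qed
    from psd_kernel_pairing_nonneg[OF assms(1,2) this]
    show ?thesis by (simp add: mult_ac)
  qed
  moreover have "K j i * L j i = cnj (K i j * L i j)" if "i \<in> I" "j \<in> I" for i j
    using psd_kernel_hermitian[OF assms(2) that] psd_kernel_hermitian[OF assms(3) that] by simp
  ultimately show ?thesis
    by (rule psd_kernelI[rotated])
qed

lemma psd_kernel_add:
  assumes "psd_kernel I K" "psd_kernel I L"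
  shows "psd_kernel I (\<lambda>i j. K i j + L i j)"
proof (rule psd_kernelI)
  fix i j assume "i \<in> I" "j \<in> I"
  then show "K j i + L j i = cnj (K i j + L i j)"
    using psd_kernel_hermitian[OF assms(1), of i j] psd_kernel_hermitian[OF assms(2), of i j] by simp
next
  fix c
  show "0 \<le> (\<Sum>i\<in>I. \<Sum>j\<in>I. c i * (K i j + L i j) * cnj (c j))"
    using add_nonneg_nonneg[OF psd_kernel_form_nonneg[OF assms(1)] psd_kernel_form_nonneg[OF assms(2)], of c c]
    by (simp add: ring_distribs sum.distrib)
qed

lemma psd_kernel_zero: "psd_kernel I (\<lambda>i j. 0)"
  by (simp add: psd_kernel_def)

lemma psd_kernel_one: "psd_kernel I (\<lambda>i j. 1)"
  by (rule psd_kernel_gram[where S = "{()}" and v = "\<lambda>_ _. 1"]) simp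

text \<open>A Gram representation composes with any map of the index sets, injective or not.\<close>

lemma psd_kernel_pullback:
  assumes "finite I" "psd_kernel I K" "f ` J \<subseteq> I"
  shows "psd_kernel J (\<lambda>i j. K (f i) (f j))"
proof -
  obtain v where v: "\<forall>i\<in>I. \<forall>j\<in>I. K i j = (\<Sum>k\<in>I. v k i * cnj (v k j))"
    using psd_kernel_imp_gram[OF assms(1,2)] by blast
  show ?thesis
    by (rule psd_kernel_gram[where S = I and v = "\<lambda>k j. v k (f j)"]) (use v assms(3) in auto)
qed

section \<open>Differences of entrywise products\<close>

lemma psd_kernel_prod:
  assumes "finite J" "finite I" "\<And>k. k \<in> J \<Longrightarrow> psd_kernel I (a k)"
  shows "psd_kernel I (\<lambda>i j. \<Prod>k\<in>J. a k i j)"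
  using assms(1,3)
  by (induction J rule: finite_induct) (auto intro!: psd_kernel_one psd_kernel_times assms(2))

text \<open>In this lemma and the next two, splitting off one factor expresses a difference of the longer
  products as a combination, with the kernels of that factor as coefficients, of differences of
  the same or lower order of the shorter products.  Every sign in the combination is positive, so
  the closure properties apply.\<close>

lemma psd_kernel_prod_first_difference:
  assumes "finite J" "finite I" "\<And>k. k \<in> J \<Longrightarrow> psd_kernel I (a k)" "\<And>k. k \<in> J \<Longrightarrow> psd_kernel I (b k)"
  shows "psd_kernel I (\<lambda>i j. (\<Prod>k\<in>J. a k i j + b k i j) - (\<Prod>k\<in>J. a k i j))"
  using assms(1,3,4)
proof (induction J rule: finite_induct)
  case empty
  then show ?case by (simp add: psd_kernel_zero)
next
  case (insert l J)
  have "psd_kernel I (\<lambda>i j. a l i j * ((\<Prod>k\<in>J. a k i j + b k i j) - (\<Prod>k\<in>J. a k i j))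
      + b l i j * (\<Prod>k\<in>J. a k i j + b k i j))"
    using insert by (intro psd_kernel_add psd_kernel_times psd_kernel_prod assms(2)) auto
  then show ?case using insert.hyps by (simp add: algebra_simps)
qed

lemma psd_kernel_prod_second_difference:
  assumes "finite J" "finite I" "\<And>k. k \<in> J \<Longrightarrow> psd_kernel I (a k)" "\<And>k. k \<in> J \<Longrightarrow> psd_kernel I (b k)"
    "\<And>k. k \<in> J \<Longrightarrow> psd_kernel I (c k)"
  shows "psd_kernel I (\<lambda>i j. (\<Prod>k\<in>J. a k i j + b k i j + c k i j) + (\<Prod>k\<in>J. a k i j)
      - (\<Prod>k\<in>J. a k i j + b k i j) - (\<Prod>k\<in>J. a k i j + c k i j))"
  using assms(1,3,4,5)
proof (induction J rule: finite_induct)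
  case empty
  then show ?case by (simp add: psd_kernel_zero)
next
  case (insert l J)
  have "psd_kernel I (\<lambda>i j. a l i j * ((\<Prod>k\<in>J. a k i j + b k i j + c k i j) + (\<Prod>k\<in>J. a k i j)
      - (\<Prod>k\<in>J. a k i j + b k i j) - (\<Prod>k\<in>J. a k i j + c k i j))
      + b l i j * ((\<Prod>k\<in>J. (a k i j + b k i j) + c k i j) - (\<Prod>k\<in>J. a k i j + b k i j))
      + c l i j * ((\<Prod>k\<in>J. (a k i j + c k i j) + b k i j) - (\<Prod>k\<in>J. a k i j + c k i j)))"
    using insert by (intro psd_kernel_add psd_kernel_times psd_kernel_prod_first_difference assms(2)) auto
  then show ?case using insert.hyps by (simp add: algebra_simps)
qed

lemma psd_kernel_prod_third_difference:
  assumes "finite J" "finite I" "\<And>k. k \<in> J \<Longrightarrow> psd_kernel I (a k)" "\<And>k. k \<in> J \<Longrightarrow> psd_kernel I (b k)"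
    "\<And>k. k \<in> J \<Longrightarrow> psd_kernel I (c k)"
  shows "psd_kernel I (\<lambda>i j. (\<Prod>k\<in>J. a k i j + b k i j + c k i j)
      + (\<Prod>k\<in>J. a k i j) + (\<Prod>k\<in>J. b k i j) + (\<Prod>k\<in>J. c k i j)
      - (\<Prod>k\<in>J. a k i j + b k i j) - (\<Prod>k\<in>J. a k i j + c k i j) - (\<Prod>k\<in>J. b k i j + c k i j))"
  using assms(1,3,4,5)
proof (induction J rule: finite_induct)
  case empty
  then show ?case by (simp add: psd_kernel_one)
next
  case (insert l J)
  have "psd_kernel I (\<lambda>i j.
      a l i j * ((\<Prod>k\<in>J. a k i j + b k i j + c k i j) + (\<Prod>k\<in>J. a k i j)
        - (\<Prod>k\<in>J. a k i j + b k i j) - (\<Prod>k\<in>J. a k i j + c k i j))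
      + b l i j * ((\<Prod>k\<in>J. b k i j + a k i j + c k i j) + (\<Prod>k\<in>J. b k i j)
        - (\<Prod>k\<in>J. b k i j + a k i j) - (\<Prod>k\<in>J. b k i j + c k i j))
      + c l i j * ((\<Prod>k\<in>J. c k i j + a k i j + b k i j) + (\<Prod>k\<in>J. c k i j)
        - (\<Prod>k\<in>J. c k i j + a k i j) - (\<Prod>k\<in>J. c k i j + b k i j)))"
    using insert by (intro psd_kernel_add psd_kernel_times psd_kernel_prod_second_difference assms(2)) auto
  then show ?case using insert.hyps by (simp add: algebra_simps)
qed


section \<open>Characters give nonnegative quadratic forms\<close>

lemma sum_swap_pairs:
  "(\<Sum>k\<in>A. \<Sum>l\<in>B. \<Sum>i\<in>C. \<Sum>j\<in>D. f k l i j) = (\<Sum>i\<in>C. \<Sum>j\<in>D. \<Sum>k\<in>A. \<Sum>l\<in>B. f k l i j)"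
proof -
  have "(\<Sum>k\<in>A. \<Sum>l\<in>B. \<Sum>i\<in>C. \<Sum>j\<in>D. f k l i j) = (\<Sum>k\<in>A. \<Sum>i\<in>C. \<Sum>j\<in>D. \<Sum>l\<in>B. f k l i j)"
    by (subst sum.swap, subst (2) sum.swap) (rule refl)
  also have "\<dots> = (\<Sum>i\<in>C. \<Sum>j\<in>D. \<Sum>k\<in>A. \<Sum>l\<in>B. f k l i j)"
    by (subst sum.swap, subst (2) sum.swap) (rule refl)
  finally show ?thesis .
qed

text \<open>The form of \<open>R S R\<^sup>*\<close> takes at \<open>a\<close> the value that the form of \<open>S\<close> takes at the row vector \<open>a R\<close>.\<close>

lemma congruence_form_nonneg:
  assumes S: "\<And>u. 0 \<le> (\<Sum>k\<in>J. \<Sum>l\<in>J. u k * S k l * cnj (u l))"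
  shows "0 \<le> (\<Sum>i\<in>I. \<Sum>j\<in>I. a i * (\<Sum>k\<in>J. \<Sum>l\<in>J. R i k * S k l * cnj (R j l)) * cnj (a j))"
proof -
  define u where "u k = (\<Sum>i\<in>I. a i * R i k)" for k
  have "(\<Sum>k\<in>J. \<Sum>l\<in>J. u k * S k l * cnj (u l))
      = (\<Sum>k\<in>J. \<Sum>l\<in>J. \<Sum>i\<in>I. \<Sum>j\<in>I. a i * (R i k * S k l * cnj (R j l)) * cnj (a j))"
  proof (intro sum.cong refl)
    fix k l
    have "u k * S k l * cnj (u l) = S k l * (u k * cnj (u l))"
      by (simp only: mult_ac)
    also have "u k * cnj (u l) = (\<Sum>i\<in>I. \<Sum>j\<in>I. (a i * R i k) * (cnj (a j) * cnj (R j l)))"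
      by (simp add: u_def sum_product)
    also have "S k l * \<dots> = (\<Sum>i\<in>I. \<Sum>j\<in>I. a i * (R i k * S k l * cnj (R j l)) * cnj (a j))"
      by (simp add: sum_distrib_left mult_ac)
    finally show "u k * S k l * cnj (u l)
      = (\<Sum>i\<in>I. \<Sum>j\<in>I. a i * (R i k * S k l * cnj (R j l)) * cnj (a j))" .
  qed
  also have "\<dots> = (\<Sum>i\<in>I. \<Sum>j\<in>I. \<Sum>k\<in>J. \<Sum>l\<in>J. a i * (R i k * S k l * cnj (R j l)) * cnj (a j))"
    by (rule sum_swap_pairs)
  also have "\<dots> = (\<Sum>i\<in>I. \<Sum>j\<in>I. a i * (\<Sum>k\<in>J. \<Sum>l\<in>J. R i k * S k l * cnj (R j l)) * cnj (a j))"
    by (simp only: sum_distrib_left sum_distrib_right)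
  finally show ?thesis
    using S[of u] by simp
qed

lemma index_mult_mat_sum:
  assumes "A \<in> carrier_mat d d" "B \<in> carrier_mat d d" "i < d" "j < d"
  shows "(A * B) $$ (i, j) = (\<Sum>k<d. A $$ (i, k) * B $$ (k, j))"
  using assms by (simp add: scalar_prod_def atLeast0LessThan)

text \<open>Substituting \<open>w = S u\<^sup>*\<close>, where \<open>u\<^sup>*\<close> is the conjugate of \<open>u\<close>, turns the form of the inverse into
  the form of \<open>H\<close> at \<open>w\<close>.  The transpose in the hypothesis comes from the convention that the
  second argument of a form is conjugated.\<close>

lemma inverse_form_nonneg:
  fixes H S :: "complex mat"
  assumes "H \<in> carrier_mat d d" "S \<in> carrier_mat d d" "H * S = 1\<^sub>m d"
    and psd: "psd_kernel {..<d} (\<lambda>i j. H $$ (j, i))"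
  shows "0 \<le> (\<Sum>k<d. \<Sum>l<d. u k * S $$ (k, l) * cnj (u l))"
proof -
  define w where "w k = (\<Sum>l<d. S $$ (k, l) * cnj (u l))" for k
  have Hw: "cnj (u k) = (\<Sum>j<d. H $$ (k, j) * w j)" if k: "k < d" for k
  proof -
    have "(\<Sum>j<d. H $$ (k, j) * w j) = (\<Sum>j<d. \<Sum>l<d. H $$ (k, j) * S $$ (j, l) * cnj (u l))"
      by (simp add: w_def sum_distrib_left mult.assoc)
    also have "\<dots> = (\<Sum>l<d. \<Sum>j<d. H $$ (k, j) * S $$ (j, l) * cnj (u l))"
      by (rule sum.swap)
    also have "\<dots> = (\<Sum>l<d. (H * S) $$ (k, l) * cnj (u l))"
      using k assms(1,2) by (intro sum.cong) (simp_all add: index_mult_mat_sum sum_distrib_right del: index_mult_mat)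
    also have "\<dots> = (\<Sum>l<d. if l = k then cnj (u l) else 0)"
      using k by (intro sum.cong) (auto simp: assms(3))
    also have "\<dots> = cnj (u k)"
      using k by simp
    finally show ?thesis ..
  qed
  have uH: "u k = (\<Sum>j<d. H $$ (j, k) * cnj (w j))" if k: "k < d" for k
  proof -
    have "u k = cnj (\<Sum>j<d. H $$ (k, j) * w j)"
      using Hw[OF k, symmetric] by simp
    also have "\<dots> = (\<Sum>j<d. cnj (H $$ (k, j)) * cnj (w j))"
      by simp
    also have "\<dots> = (\<Sum>j<d. H $$ (j, k) * cnj (w j))"
      using k psd_kernel_hermitian[OF psd, of _ k] by (intro sum.cong) simp_all
    finally show ?thesis .
  qed
  have "(\<Sum>k<d. \<Sum>l<d. u k * S $$ (k, l) * cnj (u l)) = (\<Sum>k<d. w k * u k)"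
    by (simp add: w_def sum_distrib_left sum_distrib_right mult_ac)
  also have "\<dots> = (\<Sum>k<d. \<Sum>j<d. w k * H $$ (j, k) * cnj (w j))"
    using uH by (simp add: sum_distrib_left mult.assoc)
  also have "\<dots> \<ge> 0"
    by (rule psd_kernel_form_nonneg[OF psd])
  finally show ?thesis .
qed

lemma representation_in_GL:
  assumes "group \<Gamma>" "\<rho> \<in> hom \<Gamma> (GL_mat d)"
  shows "g \<in> carrier \<Gamma> \<Longrightarrow> \<rho> g \<in> carrier_mat d d"
    and "g \<in> carrier \<Gamma> \<Longrightarrow> h \<in> carrier \<Gamma> \<Longrightarrow> \<rho> (g \<otimes>\<^bsub>\<Gamma>\<^esub> h) = \<rho> g * \<rho> h"
    and "\<rho> \<one>\<^bsub>\<Gamma>\<^esub> = 1\<^sub>m d"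
proof -
  interpret R: ring "ring_mat TYPE(complex) d ()" by (rule ring_mat)
  show "\<rho> g \<in> carrier_mat d d" if "g \<in> carrier \<Gamma>"
    using hom_in_carrier[OF assms(2) that] by (auto simp: units_of_def Units_def ring_mat_simps)
  show "\<rho> (g \<otimes>\<^bsub>\<Gamma>\<^esub> h) = \<rho> g * \<rho> h" if "g \<in> carrier \<Gamma>" "h \<in> carrier \<Gamma>"
    using hom_mult[OF assms(2) that] by (simp add: units_of_def ring_mat_simps)
  show "\<rho> \<one>\<^bsub>\<Gamma>\<^esub> = 1\<^sub>m d"
    using hom_one[OF assms(2,1) R.units_group] by (simp add: units_of_def ring_mat_simps)
qed

text \<open>
  The matrix \<open>\<Sum>\<^sub>g \<rho>(g)\<^sup>* \<rho>(g)\<close> of Weyl's unitary trick: the standard inner product averaged over the group,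
  without the normalizing factor.
\<close>

definition averaged_form :: "('a, 'b) monoid_scheme \<Rightarrow> ('a \<Rightarrow> complex mat) \<Rightarrow> nat \<Rightarrow> complex mat" where
  "averaged_form \<Gamma> \<rho> d =
     mat d d (\<lambda>(i, j). \<Sum>g\<in>carrier \<Gamma>. \<Sum>k<d. cnj (\<rho> g $$ (k, i)) * \<rho> g $$ (k, j))"

lemma averaged_form_carrier: "averaged_form \<Gamma> \<rho> d \<in> carrier_mat d d"
  by (simp add: averaged_form_def)

lemma averaged_form_index:
  assumes "i < d" "j < d"
  shows "averaged_form \<Gamma> \<rho> d $$ (i, j) =
    (\<Sum>g\<in>carrier \<Gamma>. \<Sum>k<d. cnj (\<rho> g $$ (k, i)) * \<rho> g $$ (k, j))"
  using assms by (simp add: averaged_form_def)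

text \<open>The rows of all the matrices \<open>\<rho> g\<close> together are the Gram vectors of the averaged form.\<close>

lemma averaged_form_index_gram:
  assumes "i < d" "j < d"
  shows "averaged_form \<Gamma> \<rho> d $$ (j, i) =
    (\<Sum>p\<in>carrier \<Gamma> \<times> {..<d}. \<rho> (fst p) $$ (snd p, i) * cnj (\<rho> (fst p) $$ (snd p, j)))"
  using assms by (simp add: averaged_form_index sum.cartesian_product case_prod_unfold mult.commute)

lemma psd_kernel_averaged_form: "psd_kernel {..<d} (\<lambda>i j. averaged_form \<Gamma> \<rho> d $$ (j, i))"
  by (rule psd_kernel_gram, rule averaged_form_index_gram) simp_all

text \<open>Invariance \<open>\<rho>(s)\<^sup>* H \<rho>(s) = H\<close>, in the shape \<open>H \<rho>(s\<^sup>-\<^sup>1) = \<rho>(s)\<^sup>* H\<close>: both sides are the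
  sum of \<open>\<rho>(g)\<^sup>* \<rho>(h)\<close> over all \<open>g\<close>, \<open>h\<close> with \<open>g = h s\<close>.\<close>

lemma averaged_form_invariant:
  assumes "group \<Gamma>" "\<rho> \<in> hom \<Gamma> (GL_mat d)" "s \<in> carrier \<Gamma>" "i < d" "j < d"
  shows "(averaged_form \<Gamma> \<rho> d * \<rho> (inv\<^bsub>\<Gamma>\<^esub> s)) $$ (i, j)
    = (\<Sum>l<d. cnj (\<rho> s $$ (l, i)) * averaged_form \<Gamma> \<rho> d $$ (l, j))"
proof -
  interpret group \<Gamma> by fact
  note rep = representation_in_GL[OF assms(1,2)]
  note s = assms(3) and ij = assms(4,5)
  have "(averaged_form \<Gamma> \<rho> d * \<rho> (inv\<^bsub>\<Gamma>\<^esub> s)) $$ (i, j)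
      = (\<Sum>l<d. \<Sum>g\<in>carrier \<Gamma>. \<Sum>k<d. cnj (\<rho> g $$ (k, i)) * (\<rho> g $$ (k, l) * \<rho> (inv\<^bsub>\<Gamma>\<^esub> s) $$ (l, j)))"
    using ij by (simp add: index_mult_mat_sum[OF averaged_form_carrier rep(1)[OF inv_closed[OF s]] ij]
        averaged_form_index sum_distrib_right mult.assoc del: index_mult_mat)
  also have "\<dots> = (\<Sum>g\<in>carrier \<Gamma>. \<Sum>k<d. \<Sum>l<d. cnj (\<rho> g $$ (k, i)) * (\<rho> g $$ (k, l) * \<rho> (inv\<^bsub>\<Gamma>\<^esub> s) $$ (l, j)))"
    by (subst sum.swap, rule sum.cong[OF refl], rule sum.swap)
  also have "\<dots> = (\<Sum>g\<in>carrier \<Gamma>. \<Sum>k<d. cnj (\<rho> g $$ (k, i)) * \<rho> (g \<otimes>\<^bsub>\<Gamma>\<^esub> inv\<^bsub>\<Gamma>\<^esub> s) $$ (k, j))"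
    using s ij by (intro sum.cong refl) (simp add: rep index_mult_mat_sum[of _ d] sum_distrib_left del: index_mult_mat)
  also have "\<dots> = (\<Sum>g\<in>carrier \<Gamma>. \<Sum>k<d. cnj (\<rho> (g \<otimes>\<^bsub>\<Gamma>\<^esub> s) $$ (k, i)) * \<rho> g $$ (k, j))"
    by (rule sum.reindex_bij_witness[of _ "\<lambda>g. g \<otimes>\<^bsub>\<Gamma>\<^esub> s" "\<lambda>g. g \<otimes>\<^bsub>\<Gamma>\<^esub> inv\<^bsub>\<Gamma>\<^esub> s"])
       (use s in \<open>simp_all add: m_assoc\<close>)
  also have "\<dots> = (\<Sum>g\<in>carrier \<Gamma>. \<Sum>k<d. \<Sum>l<d. cnj (\<rho> s $$ (l, i)) * (cnj (\<rho> g $$ (k, l)) * \<rho> g $$ (k, j)))"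
    using s ij by (intro sum.cong refl)
      (simp add: rep index_mult_mat_sum[of _ d] sum_distrib_right sum_distrib_left mult_ac del: index_mult_mat)
  also have "\<dots> = (\<Sum>l<d. \<Sum>g\<in>carrier \<Gamma>. \<Sum>k<d. cnj (\<rho> s $$ (l, i)) * (cnj (\<rho> g $$ (k, l)) * \<rho> g $$ (k, j)))"
    by (rule trans[OF sum.cong[OF refl sum.swap] sum.swap])
  also have "\<dots> = (\<Sum>l<d. cnj (\<rho> s $$ (l, i)) * averaged_form \<Gamma> \<rho> d $$ (l, j))"
    using ij by (simp add: averaged_form_index sum_distrib_left)
  finally show ?thesis .
qed

text \<open>The form at \<open>x\<close> is the sum of the squared norms of the vectors \<open>\<rho> g\<close> applied to \<open>x\<close>.  If it
  vanishes, then so does the term of the neutral element, which is the squared norm of \<open>x\<close>.\<close>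

lemma averaged_form_invertible:
  assumes "group \<Gamma>" "finite (carrier \<Gamma>)" "\<rho> \<in> hom \<Gamma> (GL_mat d)"
  obtains S where "S \<in> carrier_mat d d" "averaged_form \<Gamma> \<rho> d * S = 1\<^sub>m d" "S * averaged_form \<Gamma> \<rho> d = 1\<^sub>m d"
proof -
  interpret group \<Gamma> by fact
  note rep = representation_in_GL[OF assms(1,3)]
  let ?H = "averaged_form \<Gamma> \<rho> d" and ?P = "carrier \<Gamma> \<times> {..<d}"
  have "det ?H \<noteq> 0"
  proof
    assume "det ?H = 0"
    then obtain x where x: "x \<in> carrier_vec d" "x \<noteq> 0\<^sub>v d" "?H *\<^sub>v x = 0\<^sub>v d"
      using det_0_iff_vec_prod_zero[OF averaged_form_carrier] by blast
    define v where "v p i = \<rho> (fst p) $$ (snd p, i)" for p i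
    have Hx: "(\<Sum>i<d. x $ i * ?H $$ (j, i)) = 0" if "j < d" for j
    proof -
      have "(?H *\<^sub>v x) $ j = 0" using x(3) that by simp
      then show ?thesis
        using that x(1) averaged_form_carrier[of \<Gamma> \<rho> d]
        by (simp add: scalar_prod_def atLeast0LessThan mult.commute)
    qed
    have "complex_of_real (\<Sum>p\<in>?P. (cmod (\<Sum>i<d. x $ i * v p i))\<^sup>2)
        = (\<Sum>i<d. \<Sum>j<d. x $ i * (\<Sum>p\<in>?P. v p i * cnj (v p j)) * cnj (x $ j))"
      by (rule gram_form[symmetric])
    also have "\<dots> = (\<Sum>i<d. \<Sum>j<d. x $ i * ?H $$ (j, i) * cnj (x $ j))"
      by (simp add: averaged_form_index_gram v_def)
    also have "\<dots> = (\<Sum>j<d. (\<Sum>i<d. x $ i * ?H $$ (j, i)) * cnj (x $ j))"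
      by (subst sum.swap) (simp add: sum_distrib_right)
    also have "\<dots> = 0"
      by (simp add: Hx)
    finally have "(\<Sum>p\<in>?P. (cmod (\<Sum>i<d. x $ i * v p i))\<^sup>2) = 0"
      by (simp only: of_real_eq_0_iff)
    then have z: "(\<Sum>i<d. x $ i * v p i) = 0" if "p \<in> ?P" for p
      using that assms(2) by (subst (asm) sum_nonneg_eq_0_iff) auto
    have "x $ k = 0" if k: "k < d" for k
    proof -
      have "0 = (\<Sum>i<d. x $ i * v (\<one>\<^bsub>\<Gamma>\<^esub>, k) i)"
        using z[of "(\<one>\<^bsub>\<Gamma>\<^esub>, k)"] k by simp
      also have "\<dots> = (\<Sum>i<d. if i = k then x $ i else 0)"
        using k by (intro sum.cong) (auto simp: v_def rep(3))
      also have "\<dots> = x $ k"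
        using k by simp
      finally show ?thesis by simp
    qed
    then have "x = 0\<^sub>v d" using x(1) by (intro eq_vecI) auto
    with x(2) show False by simp
  qed
  from det_non_zero_imp_unit[OF averaged_form_carrier this, of "()"]
  show ?thesis
    using that by (auto simp: Units_def ring_mat_simps)
qed

text \<open>Since \<open>H\<close> intertwines \<open>\<rho>(s\<^sup>-\<^sup>1)\<close> with \<open>\<rho>(s)\<^sup>*\<close>, the trace of \<open>\<rho>(t s\<^sup>-\<^sup>1)\<close> is that of
  \<open>\<rho>(t) S \<rho>(s)\<^sup>* H\<close> with \<open>S = H\<^sup>-\<^sup>1\<close>.  Summed against \<open>c\<close>, this becomes the pairing of \<open>H\<close> with
  \<open>L = R S R\<^sup>*\<close>, where \<open>R\<close> is the sum of the \<open>\<rho>(t)\<close> with coefficients \<open>cnj (c t)\<close>.\<close>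

lemma character_form_nonneg:
  assumes "group \<Gamma>" "finite (carrier \<Gamma>)" "\<rho> \<in> hom \<Gamma> (GL_mat d)"
  shows "0 \<le> (\<Sum>s\<in>carrier \<Gamma>. \<Sum>t\<in>carrier \<Gamma>. c s * mat_trace (\<rho> (t \<otimes>\<^bsub>\<Gamma>\<^esub> inv\<^bsub>\<Gamma>\<^esub> s)) * cnj (c t))"
proof -
  interpret group \<Gamma> by fact
  note rep = representation_in_GL[OF assms(1,3)]
  let ?H = "averaged_form \<Gamma> \<rho> d" and ?C = "carrier \<Gamma>"
  note H = averaged_form_carrier[of \<Gamma> \<rho> d]
  obtain S where S: "S \<in> carrier_mat d d" "?H * S = 1\<^sub>m d" "S * ?H = 1\<^sub>m d"
    using averaged_form_invertible[OF assms] .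
  define adj where "adj s = mat d d (\<lambda>(i, j). cnj (\<rho> s $$ (j, i)))" for s
  have adj: "adj s \<in> carrier_mat d d" for s
    by (simp add: adj_def)
  define L where "L i j = (\<Sum>k<d. \<Sum>l<d. (\<Sum>t\<in>?C. cnj (c t) * \<rho> t $$ (i, k)) * S $$ (k, l)
      * cnj (\<Sum>s\<in>?C. cnj (c s) * \<rho> s $$ (j, l)))" for i j
  have trace: "mat_trace (\<rho> (t \<otimes>\<^bsub>\<Gamma>\<^esub> inv\<^bsub>\<Gamma>\<^esub> s))
      = (\<Sum>i<d. \<Sum>j<d. ?H $$ (j, i) * (\<Sum>k<d. \<Sum>l<d. \<rho> t $$ (i, k) * S $$ (k, l) * cnj (\<rho> s $$ (j, l))))"
    if st: "s \<in> ?C" "t \<in> ?C" for s t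
  proof -
    note car = S(1) H adj rep(1)[OF st(1)] rep(1)[OF st(2)] rep(1)[OF inv_closed[OF st(1)]]
    have inv: "?H * \<rho> (inv\<^bsub>\<Gamma>\<^esub> s) = adj s * ?H"
    proof (rule eq_matI)
      fix i j assume "i < dim_row (adj s * ?H)" "j < dim_col (adj s * ?H)"
      then have ij: "i < d" "j < d" using adj[of s] H by auto
      show "(?H * \<rho> (inv\<^bsub>\<Gamma>\<^esub> s)) $$ (i, j) = (adj s * ?H) $$ (i, j)"
        unfolding averaged_form_invariant[OF assms(1,3) st(1) ij] index_mult_mat_sum[OF adj H ij]
        using ij by (simp add: adj_def)
    qed (use car(2,6) adj[of s] in auto)
    have "\<rho> (inv\<^bsub>\<Gamma>\<^esub> s) = (S * ?H) * \<rho> (inv\<^bsub>\<Gamma>\<^esub> s)"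
      using car by (simp add: S(3))
    also have "\<dots> = S * (adj s * ?H)"
      using car by (simp add: assoc_mult_mat[of _ d d _ d _ d] inv)
    finally have inv': "\<rho> (inv\<^bsub>\<Gamma>\<^esub> s) = S * (adj s * ?H)" .
    have "\<rho> (t \<otimes>\<^bsub>\<Gamma>\<^esub> inv\<^bsub>\<Gamma>\<^esub> s) = \<rho> t * (S * (adj s * ?H))"
      using st by (simp add: rep(2) flip: inv')
    also have "\<dots> = (\<rho> t * (S * adj s)) * ?H"
      using car by (simp add: assoc_mult_mat[of _ d d _ d _ d])
    finally have eq: "\<rho> (t \<otimes>\<^bsub>\<Gamma>\<^esub> inv\<^bsub>\<Gamma>\<^esub> s) = (\<rho> t * (S * adj s)) * ?H" .
    have car2: "S * adj s \<in> carrier_mat d d" "\<rho> t * (S * adj s) \<in> carrier_mat d d"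
      using car by auto
    have entry: "(\<rho> t * (S * adj s)) $$ (i, j) = (\<Sum>k<d. \<Sum>l<d. \<rho> t $$ (i, k) * S $$ (k, l) * cnj (\<rho> s $$ (j, l)))"
      if "i < d" "j < d" for i j
      using that car car2
      by (simp add: index_mult_mat_sum[of _ d] adj_def sum_distrib_left mult.assoc del: index_mult_mat)
    have "mat_trace (\<rho> (t \<otimes>\<^bsub>\<Gamma>\<^esub> inv\<^bsub>\<Gamma>\<^esub> s)) = (\<Sum>i<d. ((\<rho> t * (S * adj s)) * ?H) $$ (i, i))"
      unfolding eq mat_trace_def using car by (intro sum.cong) auto
    also have "\<dots> = (\<Sum>i<d. \<Sum>j<d. (\<rho> t * (S * adj s)) $$ (i, j) * ?H $$ (j, i))"
      by (intro sum.cong refl index_mult_mat_sum[OF car2(2) H]) auto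
    also have "\<dots> = (\<Sum>i<d. \<Sum>j<d. ?H $$ (j, i) * (\<Sum>k<d. \<Sum>l<d. \<rho> t $$ (i, k) * S $$ (k, l) * cnj (\<rho> s $$ (j, l))))"
      by (intro sum.cong refl) (simp add: entry mult.commute del: index_mult_mat)
    finally show ?thesis .
  qed
  have L_eq: "L i j = (\<Sum>s\<in>?C. \<Sum>t\<in>?C. c s * cnj (c t) *
      (\<Sum>k<d. \<Sum>l<d. \<rho> t $$ (i, k) * S $$ (k, l) * cnj (\<rho> s $$ (j, l))))" for i j
  proof -
    have "(\<Sum>t\<in>?C. cnj (c t) * \<rho> t $$ (i, k)) * S $$ (k, l) * cnj (\<Sum>s\<in>?C. cnj (c s) * \<rho> s $$ (j, l))
        = (\<Sum>s\<in>?C. \<Sum>t\<in>?C. c s * cnj (c t) * (\<rho> t $$ (i, k) * S $$ (k, l) * cnj (\<rho> s $$ (j, l))))" for k l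
    proof -
      have "(\<Sum>t\<in>?C. cnj (c t) * \<rho> t $$ (i, k)) * S $$ (k, l) * cnj (\<Sum>s\<in>?C. cnj (c s) * \<rho> s $$ (j, l))
         = S $$ (k, l) * ((\<Sum>s\<in>?C. c s * cnj (\<rho> s $$ (j, l))) * (\<Sum>t\<in>?C. cnj (c t) * \<rho> t $$ (i, k)))"
        by simp
      also have "\<dots> = (\<Sum>s\<in>?C. \<Sum>t\<in>?C. S $$ (k, l) * ((c s * cnj (\<rho> s $$ (j, l))) * (cnj (c t) * \<rho> t $$ (i, k))))"
        by (simp only: sum_product) (simp only: sum_distrib_left)
      finally show ?thesis by (simp add: mult_ac)
    qed
    then have "L i j = (\<Sum>k<d. \<Sum>l<d. \<Sum>s\<in>?C. \<Sum>t\<in>?C.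
        c s * cnj (c t) * (\<rho> t $$ (i, k) * S $$ (k, l) * cnj (\<rho> s $$ (j, l))))"
      by (simp only: L_def)
    also have "\<dots> = (\<Sum>s\<in>?C. \<Sum>t\<in>?C. \<Sum>k<d. \<Sum>l<d.
        c s * cnj (c t) * (\<rho> t $$ (i, k) * S $$ (k, l) * cnj (\<rho> s $$ (j, l))))"
      by (rule sum_swap_pairs)
    finally show ?thesis by (simp only: sum_distrib_left)
  qed
  have "(\<Sum>s\<in>?C. \<Sum>t\<in>?C. c s * mat_trace (\<rho> (t \<otimes>\<^bsub>\<Gamma>\<^esub> inv\<^bsub>\<Gamma>\<^esub> s)) * cnj (c t))
      = (\<Sum>s\<in>?C. \<Sum>t\<in>?C. \<Sum>i<d. \<Sum>j<d. ?H $$ (j, i) * (c s * cnj (c t) *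
          (\<Sum>k<d. \<Sum>l<d. \<rho> t $$ (i, k) * S $$ (k, l) * cnj (\<rho> s $$ (j, l)))))"
  proof (intro sum.cong refl)
    fix s t assume st: "s \<in> ?C" "t \<in> ?C"
    have "c s * mat_trace (\<rho> (t \<otimes>\<^bsub>\<Gamma>\<^esub> inv\<^bsub>\<Gamma>\<^esub> s)) * cnj (c t)
        = c s * cnj (c t) * mat_trace (\<rho> (t \<otimes>\<^bsub>\<Gamma>\<^esub> inv\<^bsub>\<Gamma>\<^esub> s))"
      by (simp only: mult_ac)
    also have "\<dots> = (\<Sum>i<d. \<Sum>j<d. c s * cnj (c t) * (?H $$ (j, i) *
          (\<Sum>k<d. \<Sum>l<d. \<rho> t $$ (i, k) * S $$ (k, l) * cnj (\<rho> s $$ (j, l)))))"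
      by (simp only: trace[OF st] sum_distrib_left[where A = "{..<d}" and r = "c s * cnj (c t)"])
    finally show "c s * mat_trace (\<rho> (t \<otimes>\<^bsub>\<Gamma>\<^esub> inv\<^bsub>\<Gamma>\<^esub> s)) * cnj (c t)
        = (\<Sum>i<d. \<Sum>j<d. ?H $$ (j, i) * (c s * cnj (c t) *
          (\<Sum>k<d. \<Sum>l<d. \<rho> t $$ (i, k) * S $$ (k, l) * cnj (\<rho> s $$ (j, l)))))"
      by (simp only: mult.left_commute)
  qed
  also have "\<dots> = (\<Sum>i<d. \<Sum>j<d. \<Sum>s\<in>?C. \<Sum>t\<in>?C. ?H $$ (j, i) * (c s * cnj (c t) *
          (\<Sum>k<d. \<Sum>l<d. \<rho> t $$ (i, k) * S $$ (k, l) * cnj (\<rho> s $$ (j, l)))))"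
    by (rule sum_swap_pairs)
  also have "\<dots> = (\<Sum>i<d. \<Sum>j<d. ?H $$ (j, i) * L i j)"
    by (simp only: L_eq sum_distrib_left[where A = ?C])
  also have "\<dots> \<ge> 0"
  proof (rule psd_kernel_pairing_nonneg[OF _ psd_kernel_averaged_form])
    show "0 \<le> (\<Sum>i<d. \<Sum>j<d. a i * L i j * cnj (a j))" for a
      unfolding L_def
      by (rule congruence_form_nonneg, rule inverse_form_nonneg[OF H S(1,2) psd_kernel_averaged_form])
  qed simp
  finally show ?thesis .
qed

section \<open>Immanants as averages over the group\<close>

text \<open>For each fixed \<open>s\<close> the inner sum is already the immanant: substitute \<open>t = r \<circ> s\<close> and reindex the
  product along the permutation \<open>s\<close>.  The average over \<open>s\<close> only serves to produce a kernel.\<close>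

lemma immanant_average:
  fixes m G
  defines "\<Gamma> \<equiv> (sym_group m)\<lparr>carrier := G\<rparr>"
  assumes G: "subgroup G (sym_group m)"
  shows "of_nat (card G) * immanant m G \<chi> X
    = (\<Sum>s\<in>G. \<Sum>t\<in>G. \<chi> (t \<otimes>\<^bsub>\<Gamma>\<^esub> inv\<^bsub>\<Gamma>\<^esub> s) * (\<Prod>i=1..m. X $$ (s i - 1, t i - 1)))"
proof -
  interpret group \<Gamma>
    unfolding \<Gamma>_def by (rule group.subgroup_imp_group[OF sym_group_is_group G])
  have car: "carrier \<Gamma> = G" and mult: "x \<otimes>\<^bsub>\<Gamma>\<^esub> y = x \<circ> y" for x y
    by (simp_all add: \<Gamma>_def sym_group_mult)
  have perm: "s permutes {1..m}" if "s \<in> G" for s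
    using subgroup.subset[OF G] that by (auto simp: sym_group_carrier)
  have "immanant m G \<chi> X = (\<Sum>t\<in>G. \<chi> (t \<otimes>\<^bsub>\<Gamma>\<^esub> inv\<^bsub>\<Gamma>\<^esub> s) * (\<Prod>i=1..m. X $$ (s i - 1, t i - 1)))"
    if s: "s \<in> G" for s
  proof -
    have "immanant m G \<chi> X = (\<Sum>r\<in>G. \<chi> r * (\<Prod>i=1..m. X $$ (s i - 1, (r \<otimes>\<^bsub>\<Gamma>\<^esub> s) i - 1)))"
      unfolding immanant_def mult o_def
      by (intro sum.cong refl arg_cong2[where f = "(*)"]
          prod.reindex_bij_betw[OF permutes_imp_bij[OF perm[OF s]], symmetric])
    also have "\<dots> = (\<Sum>t\<in>G. \<chi> (t \<otimes>\<^bsub>\<Gamma>\<^esub> inv\<^bsub>\<Gamma>\<^esub> s) * (\<Prod>i=1..m. X $$ (s i - 1, t i - 1)))"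
      using s unfolding car[symmetric]
      by (intro sum.reindex_bij_witness[of _ "\<lambda>t. t \<otimes>\<^bsub>\<Gamma>\<^esub> inv\<^bsub>\<Gamma>\<^esub> s" "\<lambda>r. r \<otimes>\<^bsub>\<Gamma>\<^esub> s"]) (simp_all add: m_assoc)
    finally show ?thesis .
  qed
  then have "(\<Sum>s\<in>G. \<Sum>t\<in>G. \<chi> (t \<otimes>\<^bsub>\<Gamma>\<^esub> inv\<^bsub>\<Gamma>\<^esub> s) * (\<Prod>i=1..m. X $$ (s i - 1, t i - 1)))
      = (\<Sum>s\<in>G. immanant m G \<chi> X)"
    by (intro sum.cong) simp_all
  then show ?thesis by simp
qed

lemma psd_mat_imp_psd_kernel:
  assumes "psd_mat A" "A \<in> carrier_mat m m"
  shows "psd_kernel {..<m} (\<lambda>i j. A $$ (i, j))"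
proof (rule psd_kernelI)
  fix i j assume ij: "i \<in> {..<m}" "j \<in> {..<m}"
  have "A $$ (j, i) = mat_adjoint A $$ (j, i)"
    using assms(1) by (simp add: psd_mat_def)
  also have "\<dots> = cnj (A $$ (i, j))"
    using ij assms(2) by (simp add: mat_adjoint_def mat_of_rows_index)
  finally show "A $$ (j, i) = cnj (A $$ (i, j))" .
next
  fix c
  have "0 \<le> (A *\<^sub>v vec m (\<lambda>i. cnj (c i))) \<bullet>c vec m (\<lambda>i. cnj (c i))"
    using assms by (auto simp: psd_mat_def)
  also have "\<dots> = (\<Sum>i<m. \<Sum>j<m. c i * A $$ (i, j) * cnj (c j))"
    using assms(2) by (simp add: scalar_prod_def atLeast0LessThan sum_distrib_right sum_distrib_left mult_ac)
  finally show "0 \<le> (\<Sum>i<m. \<Sum>j<m. c i * A $$ (i, j) * cnj (c j))" .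
qed

theorem corollary2p3:
  fixes m :: nat
    and G :: "(nat \<Rightarrow> nat) set"
    and \<chi> :: "(nat \<Rightarrow> nat) \<Rightarrow> complex"
    and A B C :: "complex mat"
  assumes "m \<ge> 1"
    and "subgroup G (sym_group m)"
    and "irreducible_character ((sym_group m)\<lparr>carrier := G\<rparr>) \<chi>"
    and "A \<in> carrier_mat m m" and "B \<in> carrier_mat m m" and "C \<in> carrier_mat m m"
    and "psd_mat A" and "psd_mat B" and "psd_mat C"
  shows "immanant m G \<chi> (A + B + C) + immanant m G \<chi> A + immanant m G \<chi> B + immanant m G \<chi> C
      \<ge> immanant m G \<chi> (A + B) + immanant m G \<chi> (A + C) + immanant m G \<chi> (B + C)"
proof -
  define \<Gamma> where "\<Gamma> = (sym_group m)\<lparr>carrier := G\<rparr>"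
  interpret group \<Gamma>
    unfolding \<Gamma>_def by (rule group.subgroup_imp_group[OF sym_group_is_group assms(2)])
  have car: "carrier \<Gamma> = G"
    by (simp add: \<Gamma>_def)
  have perm: "s permutes {1..m}" if "s \<in> G" for s
    using subgroup.subset[OF assms(2)] that by (auto simp: sym_group_carrier)
  have fin: "finite G"
    by (rule finite_subset[OF _ finite_permutations[of "{1..m}"]]) (use perm in auto)
  have card: "card G > 0"
    using fin one_closed by (auto simp: card_gt_0_iff car)
  have index: "s i - 1 < m" if "s \<in> G" "i \<in> {1..m}" for s i
    using permutes_in_image[OF perm[OF that(1)], of i] that(2) by auto
  obtain d \<rho> where \<rho>: "\<rho> \<in> hom \<Gamma> (GL_mat d)" and \<chi>: "\<And>g. g \<in> G \<Longrightarrow> \<chi> g = mat_trace (\<rho> g)"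
    using assms(3) by (auto simp: irreducible_character_def irreducible_rep_def \<Gamma>_def)
  define M where "M X s t = (\<Prod>i=1..m. X $$ (s i - 1, t i - 1))" for X :: "complex mat" and s t :: "nat \<Rightarrow> nat"
  define N where "N s t = M (A + B + C) s t + M A s t + M B s t + M C s t
      - M (A + B) s t - M (A + C) s t - M (B + C) s t" for s t
  have entries: "psd_kernel G (\<lambda>s t. X $$ (s i - 1, t i - 1))"
    if "psd_mat X" "X \<in> carrier_mat m m" "i \<in> {1..m}" for X i
    using psd_kernel_pullback[OF _ psd_mat_imp_psd_kernel[OF that(1,2)], of "\<lambda>s. s i - 1" G] index that(3)
    by auto
  have "psd_kernel G (\<lambda>s t. (\<Prod>i=1..m. A $$ (s i - 1, t i - 1) + B $$ (s i - 1, t i - 1) + C $$ (s i - 1, t i - 1))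
      + M A s t + M B s t + M C s t
      - (\<Prod>i=1..m. A $$ (s i - 1, t i - 1) + B $$ (s i - 1, t i - 1))
      - (\<Prod>i=1..m. A $$ (s i - 1, t i - 1) + C $$ (s i - 1, t i - 1))
      - (\<Prod>i=1..m. B $$ (s i - 1, t i - 1) + C $$ (s i - 1, t i - 1)))" (is "psd_kernel G ?N")
    unfolding M_def by (rule psd_kernel_prod_third_difference) (use fin entries assms in auto)
  moreover have "?N s t = N s t" if "s \<in> G" "t \<in> G" for s t
    using index[OF that(1)] index[OF that(2)] assms(4-6) by (simp add: N_def M_def add.assoc)
  ultimately have N: "psd_kernel G N"
    by (rule psd_kernel_cong)
  have "0 \<le> (\<Sum>s\<in>G. \<Sum>t\<in>G. N s t * \<chi> (t \<otimes>\<^bsub>\<Gamma>\<^esub> inv\<^bsub>\<Gamma>\<^esub> s))"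
  proof (rule psd_kernel_pairing_nonneg[OF fin N])
    fix c
    have "t \<otimes>\<^bsub>\<Gamma>\<^esub> inv\<^bsub>\<Gamma>\<^esub> s \<in> G" if "s \<in> G" "t \<in> G" for s t
      using that inv_closed m_closed by (simp add: car)
    then show "0 \<le> (\<Sum>s\<in>G. \<Sum>t\<in>G. c s * \<chi> (t \<otimes>\<^bsub>\<Gamma>\<^esub> inv\<^bsub>\<Gamma>\<^esub> s) * cnj (c t))"
      using character_form_nonneg[OF is_group _ \<rho>, of c] fin by (simp add: car \<chi>)
  qed
  also have "\<dots> = of_nat (card G) * (immanant m G \<chi> (A + B + C) + immanant m G \<chi> A + immanant m G \<chi> B + immanant m G \<chi> C
      - immanant m G \<chi> (A + B) - immanant m G \<chi> (A + C) - immanant m G \<chi> (B + C))"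
    unfolding N_def M_def ring_distribs right_diff_distrib immanant_average[OF assms(2), folded \<Gamma>_def]
    by (simp add: ring_distribs sum.distrib sum_subtractf mult.commute)
  finally have "0 \<le> immanant m G \<chi> (A + B + C) + immanant m G \<chi> A + immanant m G \<chi> B + immanant m G \<chi> C
      - immanant m G \<chi> (A + B) - immanant m G \<chi> (A + C) - immanant m G \<chi> (B + C)"
    using card by (simp add: complex_nonneg_iff zero_le_mult_iff)
  then show ?thesis
    by (simp add: less_eq_complex_def)
qed

end
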